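(* Suppose that the relative interior of the domain of $p$, $\mathrm{ri}(\mathrm{dom}(p))$, is non-empty, that $\mathcal{Q}\succ0$, and that $t_k=1$ for all $k\ge1$ in Algorithm 1 (described in the context). Let $\{\mathbf{x}^k\}$ be a sequence generated by Algorithm 1 and let $\mathbf{x}^*$ be an optimal solution of $\min\{p(x_1)+\frac12\langle\mathbf{x},\mathcal{Q}\mathbf{x}\rangle-\langle\mathbf{b},\mathbf{x}\rangle\mid\mathbf{x}\in\mathcal{X}\}$. Then for all $k\ge 1$, $$\|\widehat{\mathcal{Q}}^{1/2}(\mathbf{x}^k-\mathbf{x}^* )\|\le\|\mathcal{B}\|_2^k\,\|\widehat{\mathcal{Q}}^{1/2}(\mathbf{x}^0-\mathbf{x}^* )\|+M\sum_{j=1}^k\|\mathcal{B}\|_2^{k-j}\epsilon_j,$$ where $\widehat{\mathcal{Q}}=\mathcal{Q}+\mathcal{T}_{\mathcal{Q}}$, $\mathcal{B}=I-\widehat{\mathcal{Q}}^{-1/2}\mathcal{Q}\widehat{\mathcal{Q}}^{-1/2}$ and $M=2\|\mathcal{D}^{-1/2}\|_2+\|\widehat{\mathcal{Q}}^{-1/2}\|_2$ (with the convention $0^0=1$). Moreover, $0\preceq\mathcal{B}\prec I$.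
   Context: Let $s\ge 2$, $\mathcal{X}_i=\mathbb{R}^{n_i}$ for $i=1,\ldots,s$, and $\mathcal{X}=\mathcal{X}_1\times\cdots\times\mathcal{X}_s$; write $\mathbf{x}=(x_1;\ldots;x_s)\in\mathcal{X}$, with the standard inner product and Euclidean norm. Let $\mathcal{Q}$ be a symmetric positive semidefinite block matrix on $\mathcal{X}$ whose $(i,j)$ block for $i\le j$ is $Q_{i,j}\in\mathbb{R}^{n_i\times n_j}$ and whose $(j,i)$ block for $i<j$ is $Q_{i,j}^*$ ($^*$ denotes transpose), with every diagonal block $Q_{i,i}$ symmetric positive definite. Let $\mathcal{U}$ be the strictly block upper triangular part of $\mathcal{Q}$ and $\mathcal{D}=\mathrm{diag}(Q_{1,1},\ldots,Q_{s,s})$, so $\mathcal{Q}=\mathcal{U}+\mathcal{D}+\mathcal{U}^*$; let $\mathcal{T}_{\mathcal{Q}}=\mathcal{U}\mathcal{D}^{-1}\mathcal{U}^*$. The matrix $\widehat{\mathcal{Q}}=\mathcal{Q}+\mathcal{T}_{\mathcal{Q}}=(\mathcal{D}+\mathcal{U})\mathcal{D}^{-1}(\mathcal{D}+\mathcal{U}^* )$ is positive definite. Let $\mathbf{b}\in\mathcal{X}$, $q(\mathbf{x})=\frac12\langle\mathbf{x},\mathcal{Q}\mathbf{x}\rangle-\langle\mathbf{b},\mathbf{x}\rangle$, and let $p:\mathcal{X}_1\to(-\infty,\infty]$ be a proper closed convex function. For a symmetric positive semidefinite $\mathcal{T}$, $\|\mathbf{x}\|_{\mathcal{T}}^2=\langle\mathbf{x},\mathcal{T}\mathbf{x}\rangle$;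 $\|\cdot\|_2$ is the spectral norm; $A\prec B$ (resp. $A\preceq B$) means $B-A$ is symmetric positive definite (resp. semidefinite). For $\boldsymbol{\delta}',\boldsymbol{\delta}\in\mathcal{X}$, $\Delta(\boldsymbol{\delta}',\boldsymbol{\delta})=\boldsymbol{\delta}+\mathcal{U}\mathcal{D}^{-1}(\boldsymbol{\delta}-\boldsymbol{\delta}')$. Algorithm 1. Input: $\widetilde{\mathbf{x}}^1=\mathbf{x}^0\in\mathrm{dom}(p)\times\mathbb{R}^{n_2}\times\cdots\times\mathbb{R}^{n_s}$, $t_1=1$, and a summable sequence of nonnegative numbers $\{\epsilon_k\}_{k\ge 1}$. For $k=1,2,\ldots$: Step 1. Compute $$\mathbf{x}^k=\operatorname*{argmin}_{\mathbf{x}\in\mathcal{X}}\Big\{p(x_1)+q(\mathbf{x})+\tfrac12\|\mathbf{x}-\widetilde{\mathbf{x}}^k\|_{\mathcal{T}_{\mathcal{Q}}}^2-\langle\mathbf{x},\Delta(\widetilde{\boldsymbol{\delta}}^k,\boldsymbol{\delta}^k)\rangle\Big\},$$ where $\widetilde{\boldsymbol{\delta}}^k,\boldsymbol{\delta}^k\in\mathcal{X}$ are error vectors with equal first blocks, $\widetilde\delta^k_1=\delta^k_1$, such that $\max\{\|\widetilde{\boldsymbol{\delta}}^k\|,\|\boldsymbol{\delta}^k\|\}\le\epsilon_k/t_k$. (The minimizer is unique, and is computed by one inexact block symmetric Gauss-Seidel cycle with these error vectors.) Step 2. Choose $t_{k+1}$ such that $t_{k+1}^2-t_{k+1}\le t_k^2$,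 set $\beta_k=\frac{t_k-1}{t_{k+1}}$ and $\widetilde{\mathbf{x}}^{k+1}=\mathbf{x}^k+\beta_k(\mathbf{x}^k-\mathbf{x}^{k-1})$. (With $t_k=1$ for all $k$, $\widetilde{\mathbf{x}}^{k}=\mathbf{x}^{k-1}$.) *)

theory Defs
  imports "HOL-Analysis.Analysis"
begin

definition pos_semidef :: "real^'n^'n \<Rightarrow> bool" where
  "pos_semidef A \<longleftrightarrow> transpose A = A \<and> (\<forall>x. 0 \<le> x \<bullet> (A *v x))"

definition pos_def :: "real^'n^'n \<Rightarrow> bool" where
  "pos_def A \<longleftrightarrow> transpose A = A \<and> (\<forall>x. x \<noteq> 0 \<longrightarrow> 0 < x \<bullet> (A *v x))"

definition loewner_le :: "real^'n^'n \<Rightarrow> real^'n^'n \<Rightarrow> bool" (infix "\<preceq>\<^sub>L" 50) where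
  "A \<preceq>\<^sub>L B \<longleftrightarrow> pos_semidef (B - A)"

definition loewner_less :: "real^'n^'n \<Rightarrow> real^'n^'n \<Rightarrow> bool" (infix "\<prec>\<^sub>L" 50) where
  "A \<prec>\<^sub>L B \<longleftrightarrow> pos_def (B - A)"

(* The principal square root; meaningful only for positive semidefinite A. *)
definition mat_sqrt :: "real^'n^'n \<Rightarrow> real^'n^'n" where
  "mat_sqrt A = (THE R. pos_semidef R \<and> R ** R = A)"

definition mat_inv_sqrt :: "real^'n^'n \<Rightarrow> real^'n^'n" where
  "mat_inv_sqrt A = matrix_inv (mat_sqrt A)"

definition spectral_norm :: "real^'n^'n \<Rightarrow> real" where
  "spectral_norm A = onorm ((*v) A)"

definition weighted_norm_sq :: "real^'n^'n \<Rightarrow> real^'n \<Rightarrow> real" where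
  "weighted_norm_sq T x = x \<bullet> (T *v x)"


(* The product R^(n_1) x ... x R^(n_s) is real^'n, where blk assigns to each coordinate the
   number of its block: n_i = card {a. blk a = i}. The factor R^(n_1), on which p is defined,
   is also the type real^'m of its own: e enumerates the coordinates of block 1. *)
definition block_structure :: "nat \<Rightarrow> ('n::finite \<Rightarrow> nat) \<Rightarrow> ('m::finite \<Rightarrow> 'n) \<Rightarrow> bool" where
  "block_structure s blk e \<longleftrightarrow> range blk = {1..s} \<and> bij_betw e UNIV {a. blk a = 1}"

definition first_block :: "('m \<Rightarrow> 'n) \<Rightarrow> real^'n \<Rightarrow> real^'m" where
  "first_block e x = (\<chi> j. x $ e j)"

(* The diagonal block Q_ii is symmetric positive definite; a vector of R^(n_i) is represented
   by its extension by zero to the coordinates of the other blocks. *)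
definition diag_block_pos_def :: "('n::finite \<Rightarrow> nat) \<Rightarrow> real^'n^'n \<Rightarrow> nat \<Rightarrow> bool" where
  "diag_block_pos_def blk Q i \<longleftrightarrow>
     (\<forall>a b. blk a = i \<longrightarrow> blk b = i \<longrightarrow> Q $ a $ b = Q $ b $ a) \<and>
     (\<forall>x. (\<forall>a. blk a \<noteq> i \<longrightarrow> x $ a = 0) \<longrightarrow> x \<noteq> 0 \<longrightarrow> 0 < x \<bullet> (Q *v x))"

definition block_upper :: "('n::finite \<Rightarrow> nat) \<Rightarrow> real^'n^'n \<Rightarrow> real^'n^'n" where
  "block_upper blk Q = (\<chi> a b. if blk a < blk b then Q $ a $ b else 0)"

definition block_diag :: "('n::finite \<Rightarrow> nat) \<Rightarrow> real^'n^'n \<Rightarrow> real^'n^'n" where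
  "block_diag blk Q = (\<chi> a b. if blk a = blk b then Q $ a $ b else 0)"

definition sgs_op :: "('n::finite \<Rightarrow> nat) \<Rightarrow> real^'n^'n \<Rightarrow> real^'n^'n" where
  "sgs_op blk Q =
     block_upper blk Q ** matrix_inv (block_diag blk Q) ** transpose (block_upper blk Q)"

definition Q_hat :: "('n::finite \<Rightarrow> nat) \<Rightarrow> real^'n^'n \<Rightarrow> real^'n^'n" where
  "Q_hat blk Q = Q + sgs_op blk Q"

definition sgs_error :: "('n::finite \<Rightarrow> nat) \<Rightarrow> real^'n^'n \<Rightarrow> real^'n \<Rightarrow> real^'n \<Rightarrow> real^'n" where
  "sgs_error blk Q \<delta>' \<delta> =
     \<delta> + (block_upper blk Q ** matrix_inv (block_diag blk Q)) *v (\<delta> - \<delta>')"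

definition iteration_matrix :: "('n::finite \<Rightarrow> nat) \<Rightarrow> real^'n^'n \<Rightarrow> real^'n^'n" where
  "iteration_matrix blk Q =
     mat 1 - mat_inv_sqrt (Q_hat blk Q) ** Q ** mat_inv_sqrt (Q_hat blk Q)"

definition error_const :: "('n::finite \<Rightarrow> nat) \<Rightarrow> real^'n^'n \<Rightarrow> real" where
  "error_const blk Q =
     2 * spectral_norm (mat_inv_sqrt (block_diag blk Q))
     + spectral_norm (mat_inv_sqrt (Q_hat blk Q))"


definition eff_dom :: "('a \<Rightarrow> ereal) \<Rightarrow> 'a set" where
  "eff_dom p = {x. p x < \<infinity>}"

definition epi :: "('a \<Rightarrow> ereal) \<Rightarrow> ('a \<times> real) set" where
  "epi p = {(x, r). p x \<le> ereal r}"

definition proper_closed_convex :: "('a::real_normed_vector \<Rightarrow> ereal) \<Rightarrow> bool" where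
  "proper_closed_convex p \<longleftrightarrow>
     (\<forall>x. p x \<noteq> -\<infinity>) \<and> eff_dom p \<noteq> {} \<and> closed (epi p) \<and> convex (epi p)"

definition quad :: "real^'n^'n \<Rightarrow> real^'n \<Rightarrow> real^'n \<Rightarrow> real" where
  "quad Q b x = 1/2 * (x \<bullet> (Q *v x)) - b \<bullet> x"

definition objective ::
  "('m \<Rightarrow> 'n) \<Rightarrow> (real^'m \<Rightarrow> ereal) \<Rightarrow> real^'n^'n \<Rightarrow> real^'n \<Rightarrow> real^'n \<Rightarrow> ereal" where
  "objective e p Q b x = p (first_block e x) + ereal (quad Q b x)"

definition step_objective ::
  "('n::finite \<Rightarrow> nat) \<Rightarrow> ('m \<Rightarrow> 'n) \<Rightarrow> (real^'m \<Rightarrow> ereal) \<Rightarrow> real^'n^'n \<Rightarrow> real^'n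
     \<Rightarrow> real^'n \<Rightarrow> real^'n \<Rightarrow> real^'n \<Rightarrow> real^'n \<Rightarrow> ereal" where
  "step_objective blk e p Q b xt \<delta>' \<delta> x =
     p (first_block e x)
     + ereal (quad Q b x + 1/2 * weighted_norm_sq (sgs_op blk Q) (x - xt)
              - x \<bullet> sgs_error blk Q \<delta>' \<delta>)"

(* (x k) is a sequence generated by the inexact accelerated block symmetric Gauss-Seidel method,
   with extrapolated points xt k, tolerances \<epsilon> k and error vectors \<delta>' k, \<delta> k.
   The entries of xt, t, \<epsilon>, \<delta>', \<delta> at index 0 play no role. *)
definition algorithm_run ::
  "('n::finite \<Rightarrow> nat) \<Rightarrow> ('m::finite \<Rightarrow> 'n) \<Rightarrow> (real^'m \<Rightarrow> ereal) \<Rightarrow> real^'n^'n \<Rightarrow> real^'n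
     \<Rightarrow> (nat \<Rightarrow> real) \<Rightarrow> (nat \<Rightarrow> real) \<Rightarrow> (nat \<Rightarrow> real^'n) \<Rightarrow> (nat \<Rightarrow> real^'n)
     \<Rightarrow> (nat \<Rightarrow> real^'n) \<Rightarrow> (nat \<Rightarrow> real^'n) \<Rightarrow> bool" where
  "algorithm_run blk e p Q b \<epsilon> t \<delta>' \<delta> xt x \<longleftrightarrow>
     xt 1 = x 0 \<and> first_block e (x 0) \<in> eff_dom p \<and> t 1 = 1 \<and>
     (\<forall>k\<ge>1. 0 \<le> \<epsilon> k) \<and> summable (\<lambda>k. \<epsilon> (Suc k)) \<and>
     (\<forall>k\<ge>1.
        first_block e (\<delta>' k) = first_block e (\<delta> k) \<and>
        max (norm (\<delta>' k)) (norm (\<delta> k)) \<le> \<epsilon> k / t k \<and>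
        is_arg_min (step_objective blk e p Q b (xt k) (\<delta>' k) (\<delta> k)) (\<lambda>_. True) (x k) \<and>
        (t (k + 1))\<^sup>2 - t (k + 1) \<le> (t k)\<^sup>2 \<and>
        xt (k + 1) = x k + ((t k - 1) / t (k + 1)) *\<^sub>R (x k - x (k - 1)))"

end

theory Submission
  imports Defs
begin

text \<open>Write H for \<^term>\<open>Q_hat blk Q\<close>, T for \<^term>\<open>sgs_op blk Q\<close>, and w(k) for the error
  of the k-th iterate. Adding the variational inequalities of the k-th subproblem, tested at the
  optimum, and of the original problem, tested at the k-th iterate, cancels p and leaves
  <H w(k), w(k)> \<le> <T w(k-1) + \<Delta>, w(k)>. In the variable H^(1/2) w the operator T becomes
  B = H^(-1/2) T H^(-1/2), so Cauchy-Schwarz gives a linear recurrence with rate the norm of B and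
  perturbation the norm of H^(-1/2) \<Delta>. The latter is controlled by
  \<Delta> = (D + U) D^(-1) (\<delta> - \<delta>') + \<delta>' and H = G G^* with G = (D + U) D^(-1/2), since
  H^(-1/2) G has norm at most 1. The square roots themselves come from the spectral theorem for
  self-adjoint operators, proved by maximising the Rayleigh quotient.\<close>


section \<open>First-order conditions and the spectral theorem for self-adjoint operators\<close>

text \<open>Divide by \<tau> and let it tend to 0 from the right. This is the first-order condition
  used both for the maximiser of the Rayleigh quotient and for minimisers of a convex function plus
  a quadratic.\<close>

lemma linear_coeff_nonneg_of_quadratic_nonneg:
  fixes a c :: real
  assumes "\<And>\<tau>. 0 < \<tau> \<Longrightarrow> \<tau> \<le> 1 \<Longrightarrow> 0 \<le> \<tau> * a + \<tau>\<^sup>2 * c"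
  shows "0 \<le> a"
proof (rule tendsto_lowerbound)
  show "((\<lambda>\<tau>. a + \<tau> * c) \<longlongrightarrow> a) (at_right 0)"
    by (auto intro!: tendsto_eq_intros)
  have "0 \<le> a + \<tau> * c" if "0 < \<tau>" "\<tau> < 1" for \<tau>
  proof -
    have "0 \<le> \<tau> * (a + \<tau> * c)"
      using assms[of \<tau>] that by (simp add: power2_eq_square algebra_simps)
    with that show ?thesis by (simp add: zero_le_mult_iff)
  qed
  then show "\<forall>\<^sub>F \<tau> in at_right 0. 0 \<le> a + \<tau> * c"
    unfolding eventually_at_right_field by (auto intro!: exI[of _ 1])
qed simp

text \<open>Compactness gives a maximiser v of the quadratic form on the unit sphere of
  \<open>S\<close>. If its residual w = f v - l v were nonzero, moving v in the direction w, which
  stays in \<open>S\<close> by invariance, would raise the quotient.\<close>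

lemma self_adjoint_eigenvector:
  fixes f :: "'a::euclidean_space \<Rightarrow> 'a"
  assumes lin: "linear f" and sym: "\<And>x y. f x \<bullet> y = x \<bullet> f y"
    and S: "subspace S" "f ` S \<subseteq> S" "S \<noteq> {0}"
  obtains v where "v \<in> S" "norm v = 1" "f v = (v \<bullet> f v) *\<^sub>R v"
proof -
  let ?K = "S \<inter> sphere 0 1"
  obtain u where u: "u \<in> S" "u \<noteq> 0" using S subspace_0 by blast
  then have "u /\<^sub>R norm u \<in> ?K" using S(1) by (auto simp: subspace_scale)
  moreover have "compact ?K" using closed_subspace[OF S(1)] by (intro closed_Int_compact) auto
  moreover have "continuous_on ?K (\<lambda>x. x \<bullet> f x)"
    by (intro continuous_intros linear_continuous_on linear_conv_bounded_linear[THEN iffD1] lin)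
  ultimately obtain v where v: "v \<in> ?K" and max: "\<And>y. y \<in> ?K \<Longrightarrow> y \<bullet> f y \<le> v \<bullet> f v"
    using continuous_attains_sup[of ?K "\<lambda>x. x \<bullet> f x"] by blast
  define l where "l = v \<bullet> f v"
  have bound: "y \<bullet> f y \<le> l * (y \<bullet> y)" if "y \<in> S" for y
  proof (cases "y = 0")
    case True
    then show ?thesis by simp
  next
    case False
    then have "y /\<^sub>R norm y \<in> ?K" using that S(1) by (auto simp: subspace_scale)
    from max[OF this] False have "(y \<bullet> f y) / (norm y)\<^sup>2 \<le> l"
      by (simp add: l_def linear_scale[OF lin] power2_eq_square field_simps)
    with False show ?thesis by (simp add: pos_divide_le_eq power2_norm_eq_inner)
  qed
  define w where "w = f v - l *\<^sub>R v"
  have wS: "w \<in> S" using v S unfolding w_def by (auto intro: subspace_diff subspace_scale)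
  have vv: "v \<bullet> v = 1" using v by (simp add: norm_eq_1)
  \<comment> \<open>This is \<open>bound\<close> at v + \<tau> w. The constant terms cancel because
    v attains l, and self-adjointness makes the two cross terms equal.\<close>
  have "0 \<le> \<tau> * (- 2 * (w \<bullet> w)) + \<tau>\<^sup>2 * (l * (w \<bullet> w) - w \<bullet> f w)" for \<tau>
  proof -
    have fw: "v \<bullet> f w = w \<bullet> w + l * (v \<bullet> w)"
      unfolding sym[symmetric] by (simp add: w_def algebra_simps inner_commute)
    have fw': "w \<bullet> f v = w \<bullet> w + l * (v \<bullet> w)"
      by (simp add: w_def algebra_simps inner_commute)
    have "v + \<tau> *\<^sub>R w \<in> S" using v wS S(1) by (auto intro: subspace_add subspace_scale)
    from bound[OF this] show ?thesis
      by (simp add: linear_add[OF lin] linear_scale[OF lin] inner_add inner_diff fw fw' vv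
          l_def[symmetric] power2_eq_square algebra_simps inner_commute[of w v])
  qed
  then have "0 \<le> - 2 * (w \<bullet> w)" by (rule linear_coeff_nonneg_of_quadratic_nonneg)
  then have "w \<bullet> w \<le> 0" by simp
  then have "w = 0" by (metis inner_ge_zero inner_eq_zero_iff order_antisym)
  then have "f v = (v \<bullet> f v) *\<^sub>R v" by (simp add: w_def l_def)
  with v that show thesis by auto
qed

text \<open>Induction on the dimension: split off a unit eigenvector v. Its orthogonal complement
  \<open>S'\<close> inside \<open>S\<close> is again invariant, since self-adjointness moves f onto
  v, which it only rescales.\<close>

lemma self_adjoint_eigenbasis:
  fixes f :: "'a::euclidean_space \<Rightarrow> 'a"
  assumes lin: "linear f" and sym: "\<And>x y. f x \<bullet> y = x \<bullet> f y"
    and "subspace S" "f ` S \<subseteq> S"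
  shows "\<exists>B. finite B \<and> span B = S \<and> pairwise orthogonal B \<and>
             (\<forall>v\<in>B. norm v = 1 \<and> f v = (v \<bullet> f v) *\<^sub>R v)"
  using assms(3,4)
proof (induction "dim S" arbitrary: S rule: less_induct)
  case less
  show ?case
  proof (cases "S = {0}")
    case True
    then show ?thesis by (intro exI[of _ "{}"]) auto
  next
    case False
    then obtain v where v: "v \<in> S" "norm v = 1" "f v = (v \<bullet> f v) *\<^sub>R v"
      using self_adjoint_eigenvector[OF lin sym] less.prems by blast
    have vv: "v \<bullet> v = 1" using v by (simp add: norm_eq_1)
    define S' where "S' = {x \<in> S. v \<bullet> x = 0}"
    have S': "subspace S'" using less.prems(1)
      by (auto simp: S'_def subspace_def inner_add)
    have fS': "f ` S' \<subseteq> S'"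
    proof
      fix y assume "y \<in> f ` S'"
      then obtain x where x: "x \<in> S" "v \<bullet> x = 0" "y = f x" by (auto simp: S'_def)
      have "v \<bullet> f x = f v \<bullet> x" by (simp add: sym)
      also have "\<dots> = 0" by (subst v(3)) (simp add: x)
      finally show "y \<in> S'" using x less.prems(2) by (auto simp: S'_def)
    qed
    have "v \<notin> S'" using vv by (simp add: S'_def)
    moreover have "S' \<subseteq> S" by (auto simp: S'_def)
    ultimately have "S' \<subset> S" using v by blast
    then have "dim S' < dim S"
      using S' less.prems(1) by (intro dim_psubset) (simp only: span_eq_iff[THEN iffD2])
    from less.hyps[OF this S' fS'] obtain B where
      B: "finite B" "span B = S'" "pairwise orthogonal B"
        "\<forall>v\<in>B. norm v = 1 \<and> f v = (v \<bullet> f v) *\<^sub>R v" by blast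
    have BS: "B \<subseteq> S'" using B(2) span_superset by blast
    have "span (insert v B) = S"
    proof
      show "span (insert v B) \<subseteq> S"
        using BS v less.prems(1) by (intro span_minimal) (auto simp: S'_def)
      show "S \<subseteq> span (insert v B)"
      proof
        fix x assume "x \<in> S"
        then have "x - (v \<bullet> x) *\<^sub>R v \<in> span B"
          using v less.prems(1) by (simp add: B(2) S'_def inner_diff vv subspace_diff subspace_scale)
        then show "x \<in> span (insert v B)" by (auto simp: span_insert)
      qed
    qed
    moreover have "pairwise orthogonal (insert v B)"
      using B(3) BS by (auto simp: pairwise_insert orthogonal_def S'_def inner_commute)
    ultimately show ?thesis using B v by (intro exI[of _ "insert v B"]) auto
  qed
qed

section \<open>Square roots and inverse square roots of matrices\<close>

lemma inner_transpose_matrix_vector: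
  fixes A :: "real^'n^'m"
  shows "x \<bullet> (A *v y) = (transpose A *v x) \<bullet> y"
  by (simp add: dot_lmul_matrix[symmetric])

lemma transpose_add: "transpose (A + B) = transpose A + transpose B"
  by (simp add: transpose_def vec_eq_iff)

lemma pos_semidef_transpose_mult: "pos_semidef (transpose V ** V)"
proof -
  have "0 \<le> x \<bullet> (transpose V ** V *v x)" for x
    using inner_ge_zero[of "V *v x"] inner_transpose_matrix_vector[of x "transpose V" "V *v x"]
    by (simp add: matrix_vector_mul_assoc del: transpose_matrix_vector)
  then show ?thesis by (simp add: pos_semidef_def matrix_transpose_mul)
qed

lemma pos_semidef_eigenbasis:
  fixes A :: "real^'n^'n"
  assumes "pos_semidef A"
  obtains B :: "(real^'n) set" and l :: "real^'n \<Rightarrow> real"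
    where "finite B" "span B = UNIV" "pairwise orthogonal B"
    "\<And>v. v \<in> B \<Longrightarrow> v \<bullet> v = 1" "\<And>v. v \<in> B \<Longrightarrow> A *v v = l v *\<^sub>R v" "\<And>v. 0 \<le> l v"
proof -
  have "(A *v x) \<bullet> y = x \<bullet> (A *v y)" for x y
    using assms by (metis inner_transpose_matrix_vector pos_semidef_def)
  then obtain B where "finite B" "span B = UNIV" "pairwise orthogonal B"
    "\<forall>v\<in>B. norm v = 1 \<and> A *v v = (v \<bullet> (A *v v)) *\<^sub>R v"
    using self_adjoint_eigenbasis[of "(*v) A" UNIV] by auto
  with that[of B "\<lambda>v. v \<bullet> (A *v v)"] assms show thesis
    by (simp add: norm_eq_1 pos_semidef_def)
qed

lemma orthonormal_sum_eigenvector: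
  assumes "finite B" "pairwise orthogonal B" "\<And>v. v \<in> B \<Longrightarrow> v \<bullet> v = 1" "u \<in> B"
  shows "(\<Sum>v\<in>B. (c v * (v \<bullet> u)) *\<^sub>R v) = c u *\<^sub>R u"
proof -
  have "(\<Sum>v\<in>B. (c v * (v \<bullet> u)) *\<^sub>R v) = (\<Sum>v\<in>B. if v = u then c u *\<^sub>R u else 0)"
    using assms by (intro sum.cong) (auto simp: pairwise_def orthogonal_def)
  with assms show ?thesis by simp
qed

lemma matrix_eq_on_span:
  fixes A A' :: "real^'n^'m"
  assumes "span B = UNIV" "\<And>v. v \<in> B \<Longrightarrow> A *v v = A' *v v"
  shows "A = A'"
proof -
  have "A *v x = A' *v x" for x
  proof (rule linear_eq_on_span[of "(*v) A" "(*v) A'" B])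
    show "x \<in> span B" by (simp add: assms(1))
  qed (simp_all add: assms(2))
  then show ?thesis by (simp add: matrix_eq)
qed

lemma pos_semidef_sqrt_exists:
  fixes A :: "real^'n^'n"
  assumes "pos_semidef A"
  shows "\<exists>R. pos_semidef R \<and> R ** R = A"
proof -
  obtain B :: "(real^'n) set" and l where B: "finite B" "span B = UNIV" "pairwise orthogonal B"
    "\<And>v. v \<in> B \<Longrightarrow> v \<bullet> v = 1" "\<And>v. v \<in> B \<Longrightarrow> A *v v = l v *\<^sub>R v" "\<And>v. 0 \<le> l v"
    using pos_semidef_eigenbasis[OF assms] by metis
  \<comment> \<open>The root is diagonal in an orthonormal eigenbasis of \<open>A\<close>, with the
    square roots of the eigenvalues on the diagonal.\<close>
  define g where "g x = (\<Sum>v\<in>B. (sqrt (l v) * (v \<bullet> x)) *\<^sub>R v)" for x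
  have "linear g"
    unfolding g_def by (intro linear_compose_sum ballI linearI)
      (simp_all add: inner_add algebra_simps)
  define R where "R = matrix g"
  have R: "R *v x = g x" for x unfolding R_def by (simp add: \<open>linear g\<close> matrix_works)
  have "x \<bullet> (R *v y) = (R *v x) \<bullet> y" for x y
    unfolding R g_def inner_sum_left inner_sum_right
    by (intro sum.cong) (simp_all add: inner_commute)
  then have "(transpose R *v x) \<bullet> y = (R *v x) \<bullet> y" for x y
    by (simp add: inner_transpose_matrix_vector)
  then have "transpose R = R" by (metis matrix_eq vector_eq_rdot)
  moreover have "0 \<le> x \<bullet> (R *v x)" for x
    unfolding R g_def inner_sum_right
    using B by (intro sum_nonneg) (simp add: inner_commute mult.assoc)
  moreover have "R ** R = A"
  proof (rule matrix_eq_on_span[OF B(2)])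
    fix v assume v: "v \<in> B"
    then have "R *v v = sqrt (l v) *\<^sub>R v"
      unfolding R g_def by (intro orthonormal_sum_eigenvector) (use B in auto)
    then show "R ** R *v v = A *v v"
      using B(5)[OF v] B(6)[of v]
      by (simp add: matrix_vector_mul_assoc[symmetric] vec.scale matrix_vector_mult_scaleR)
  qed
  ultimately show ?thesis unfolding pos_semidef_def by blast
qed

text \<open>The key to uniqueness: R^2 - l factors as (R + sqrt l)(R - sqrt l), so u = R v - sqrt l
  v satisfies R u = - sqrt l u. For l > 0 semidefiniteness forces u = 0; for l = 0, the vector R v
  has norm 0 by symmetry.\<close>

lemma pos_semidef_sqrt_eigenvector:
  fixes R :: "real^'n^'n"
  assumes R: "pos_semidef R" and ev: "R ** R *v v = l *\<^sub>R v" and "0 \<le> l"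
  shows "R *v v = sqrt l *\<^sub>R v"
proof (cases "l = 0")
  case True
  have "(R *v v) \<bullet> (R *v v) = v \<bullet> (R ** R *v v)"
    using R by (simp add: matrix_vector_mul_assoc[symmetric] inner_transpose_matrix_vector pos_semidef_def)
  with True ev show ?thesis by simp
next
  case False
  define u where "u = R *v v - sqrt l *\<^sub>R v"
  have "R *v u = - (sqrt l *\<^sub>R u)"
    using ev \<open>0 \<le> l\<close>
    by (simp add: u_def vec.diff matrix_vector_mul_assoc matrix_vector_mult_scaleR algebra_simps)
  then have "0 \<le> - (sqrt l * (u \<bullet> u))"
    using R unfolding pos_semidef_def by (metis inner_minus_right inner_scaleR_right)
  moreover have "0 < sqrt l" using False \<open>0 \<le> l\<close> by simp
  ultimately have "u \<bullet> u \<le> 0" by (simp add: mult_le_0_iff)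
  then have "u = 0" by (metis inner_ge_zero inner_eq_zero_iff order_antisym)
  then show ?thesis by (simp add: u_def)
qed

text \<open>Both roots act in the same way on an eigenbasis of their common square. This makes the
  definite description in \<open>mat_sqrt\<close> meaningful.\<close>

lemma pos_semidef_sqrt_unique:
  assumes "pos_semidef R" "pos_semidef R'" "R ** R = R' ** R'"
  shows "R = R'"
proof -
  have "pos_semidef (R ** R)"
    using pos_semidef_transpose_mult[of R] assms(1) by (simp add: pos_semidef_def)
  then obtain B l where B: "span B = UNIV"
    "\<And>v. v \<in> B \<Longrightarrow> R ** R *v v = l v *\<^sub>R v" "\<And>v. 0 \<le> l v"
    by (metis pos_semidef_eigenbasis)
  show ?thesis
    by (rule matrix_eq_on_span[OF B(1)])
      (metis B(2,3) assms pos_semidef_sqrt_eigenvector)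
qed

lemma mat_sqrt:
  assumes "pos_semidef A"
  shows "pos_semidef (mat_sqrt A)" "mat_sqrt A ** mat_sqrt A = A"
proof -
  have "\<exists>!R. pos_semidef R \<and> R ** R = A"
    using pos_semidef_sqrt_exists[OF assms] pos_semidef_sqrt_unique by metis
  from theI'[OF this] show "pos_semidef (mat_sqrt A)" "mat_sqrt A ** mat_sqrt A = A"
    unfolding mat_sqrt_def by auto
qed

lemma pos_def_imp_pos_semidef:
  assumes "pos_def A"
  shows "pos_semidef A"
proof -
  have "0 \<le> x \<bullet> (A *v x)" for x
    using assms by (cases "x = 0") (auto simp: pos_def_def less_imp_le)
  with assms show ?thesis by (simp add: pos_def_def pos_semidef_def)
qed

lemma matrix_inv_mult:
  fixes A :: "real^'n^'n"
  assumes "invertible A"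
  shows "A ** matrix_inv A = mat 1" "matrix_inv A ** A = mat 1"
  using someI_ex[OF assms[unfolded invertible_def]] unfolding matrix_inv_def by auto

lemma matrix_inv_eqI:
  fixes A B :: "real^'n^'n"
  assumes "A ** B = mat 1"
  shows "matrix_inv A = B"
proof -
  have "invertible A" using assms by (auto simp: invertible_right_inverse)
  then have "matrix_inv A ** (A ** B) = B" by (simp add: matrix_mul_assoc matrix_inv_mult)
  with assms show ?thesis by simp
qed

lemma mat_inv_sqrt:
  assumes "pos_def A"
  shows "mat_sqrt A ** mat_inv_sqrt A = mat 1" "mat_inv_sqrt A ** mat_sqrt A = mat 1"
    "transpose (mat_inv_sqrt A) = mat_inv_sqrt A"
    "mat_inv_sqrt A ** mat_inv_sqrt A = matrix_inv A"
proof -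
  note sq = mat_sqrt[OF pos_def_imp_pos_semidef[OF assms]]
  \<comment> \<open>A kernel vector of the root annihilates the quadratic form of \<open>A\<close>,
    so definiteness makes the root invertible.\<close>
  have "x = 0" if "mat_sqrt A *v x = 0" for x
  proof -
    have "x \<bullet> (A *v x) = 0"
      using that by (subst sq(2)[symmetric]) (simp add: matrix_vector_mul_assoc[symmetric])
    with assms show ?thesis unfolding pos_def_def by (metis less_irrefl)
  qed
  then have "invertible (mat_sqrt A)"
    by (simp add: invertible_left_inverse matrix_left_invertible_ker)
  then show 1: "mat_sqrt A ** mat_inv_sqrt A = mat 1" and 2: "mat_inv_sqrt A ** mat_sqrt A = mat 1"
    unfolding mat_inv_sqrt_def by (simp_all add: matrix_inv_mult)
  have "mat_sqrt A ** transpose (mat_inv_sqrt A) = mat 1"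
    using arg_cong[OF 2, of transpose] sq(1) by (simp add: matrix_transpose_mul pos_semidef_def)
  then show "transpose (mat_inv_sqrt A) = mat_inv_sqrt A"
    unfolding mat_inv_sqrt_def by (metis matrix_inv_eqI)
  have "A ** (mat_inv_sqrt A ** mat_inv_sqrt A) =
      mat_sqrt A ** (mat_sqrt A ** mat_inv_sqrt A) ** mat_inv_sqrt A"
    by (simp add: sq(2) matrix_mul_assoc)
  then show "mat_inv_sqrt A ** mat_inv_sqrt A = matrix_inv A"
    by (metis "1" matrix_inv_eqI matrix_mul_rid)
qed

section \<open>The block splitting of Q and the operator \<open>Q_hat\<close>\<close>

text \<open>The quadratic form of the block diagonal is the sum over the blocks of the form of
  \<open>Q\<close> at the restriction \<open>?P i x\<close> of x to block i. Every summand is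
  nonnegative, and one is positive when x is nonzero.\<close>

lemma pos_def_block_diag:
  fixes Q :: "real^'n^'n"
  assumes "pos_def Q"
  shows "pos_def (block_diag blk Q)"
proof -
  let ?P = "\<lambda>i x. (\<chi> a. if blk a = i then x $ a else 0) :: real^'n"
  have decomp: "x \<bullet> (block_diag blk Q *v x) = (\<Sum>i\<in>range blk. ?P i x \<bullet> (Q *v ?P i x))" for x
  proof -
    have "(\<Sum>i\<in>range blk. ?P i x \<bullet> (Q *v ?P i x)) =
      (\<Sum>i\<in>range blk. \<Sum>a\<in>UNIV. \<Sum>b\<in>UNIV. ?P i x $ a * (Q $ a $ b * ?P i x $ b))"
      by (simp add: inner_vec_def matrix_vector_mult_def sum_distrib_left)
    also have "\<dots> = (\<Sum>a\<in>UNIV. \<Sum>b\<in>UNIV. \<Sum>i\<in>range blk. ?P i x $ a * (Q $ a $ b * ?P i x $ b))"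
      by (subst sum.swap, rule sum.cong[OF refl], rule sum.swap)
    also have "\<dots> = (\<Sum>a\<in>UNIV. \<Sum>b\<in>UNIV. x $ a * (block_diag blk Q $ a $ b * x $ b))"
    proof (intro sum.cong refl)
      fix a b
      \<comment> \<open>Only i = \<open>blk a\<close> can contribute, and only if b lies in that
        same block.\<close>
      have "(\<Sum>i\<in>range blk. ?P i x $ a * (Q $ a $ b * ?P i x $ b)) =
        (\<Sum>i\<in>range blk. if i = blk a then x $ a * (block_diag blk Q $ a $ b * x $ b) else 0)"
        by (intro sum.cong) (auto simp: block_diag_def)
      then show "(\<Sum>i\<in>range blk. ?P i x $ a * (Q $ a $ b * ?P i x $ b)) =
        x $ a * (block_diag blk Q $ a $ b * x $ b)" by simp
    qed
    finally show ?thesis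
      by (simp add: inner_vec_def matrix_vector_mult_def sum_distrib_left)
  qed
  have "transpose (block_diag blk Q) = block_diag blk Q"
    using assms by (auto simp: pos_def_def block_diag_def transpose_def vec_eq_iff)
  moreover have "0 < x \<bullet> (block_diag blk Q *v x)" if "x \<noteq> 0" for x
  proof -
    obtain a where "x $ a \<noteq> 0" using \<open>x \<noteq> 0\<close> by (auto simp: vec_eq_iff)
    then have "?P (blk a) x \<noteq> 0" by (auto simp: vec_eq_iff)
    then have "0 < ?P (blk a) x \<bullet> (Q *v ?P (blk a) x)" using assms by (simp add: pos_def_def)
    moreover have "0 \<le> y \<bullet> (Q *v y)" for y
      using pos_def_imp_pos_semidef[OF assms] by (simp add: pos_semidef_def)
    ultimately show ?thesis
      unfolding decomp by (intro sum_pos2[of _ "blk a"]) auto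
  qed
  ultimately show ?thesis by (simp add: pos_def_def)
qed

lemma block_decomposition:
  assumes "transpose Q = Q"
  shows "Q = block_diag blk Q + block_upper blk Q + transpose (block_upper blk Q)"
proof -
  have "Q $ b $ a = Q $ a $ b" for a b
    using assms by (metis transpose_def vec_lambda_beta)
  then show ?thesis
    by (auto simp: vec_eq_iff block_diag_def block_upper_def transpose_def)
qed

lemma pos_semidef_sgs_op:
  assumes "pos_def Q"
  shows "pos_semidef (sgs_op blk Q)"
proof -
  define S where "S = mat_inv_sqrt (block_diag blk Q)"
  note S = mat_inv_sqrt[OF pos_def_block_diag[OF assms, of blk], folded S_def]
  \<comment> \<open>With S the inverse square root of D, the operator U D^(-1)
    \<open>transpose U\<close> is a Gram matrix.\<close>
  define V where "V = S ** transpose (block_upper blk Q)"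
  have "sgs_op blk Q = transpose V ** V"
    by (simp add: sgs_op_def V_def matrix_transpose_mul S(3) S(4)[symmetric] matrix_mul_assoc)
  then show ?thesis by (simp only: pos_semidef_transpose_mult)
qed

lemma pos_def_Q_hat:
  assumes "pos_def Q"
  shows "pos_def (Q_hat blk Q)"
proof -
  have T: "transpose (sgs_op blk Q) = sgs_op blk Q" "\<And>x. 0 \<le> x \<bullet> (sgs_op blk Q *v x)"
    using pos_semidef_sgs_op[OF assms] by (auto simp: pos_semidef_def)
  have "0 < x \<bullet> (Q *v x) + x \<bullet> (sgs_op blk Q *v x)" if "x \<noteq> 0" for x
    using assms T(2)[of x] that by (simp add: pos_def_def add_pos_nonneg)
  with assms T(1) show ?thesis
    by (simp add: pos_def_def Q_hat_def transpose_add matrix_vector_mult_add_rdistrib inner_add_right)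
qed

text \<open>Multiplying out the right-hand side gives D + U + \<open>transpose U\<close> + U D^(-1)
  \<open>transpose U\<close>. Splitting D^(-1) evenly between the outer factors will write H as G
  \<open>transpose G\<close>.\<close>

lemma Q_hat_factorization:
  fixes Q :: "real^'n^'n"
  assumes "pos_def Q" and D_def: "D = block_diag blk Q" and U_def: "U = block_upper blk Q"
  shows "Q_hat blk Q = (D + U) ** matrix_inv D ** (D + transpose U)"
proof -
  note S = mat_inv_sqrt[OF pos_def_block_diag[OF assms(1), of blk], folded D_def]
  have "D = mat_sqrt D ** mat_sqrt D"
    using mat_sqrt(2) pos_def_imp_pos_semidef pos_def_block_diag[OF assms(1)] D_def by metis
  then have "D ** (mat_inv_sqrt D ** mat_inv_sqrt D) = mat 1"
    by (metis S(1) matrix_mul_assoc matrix_mul_rid)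
  then have inv: "D ** matrix_inv D = mat 1" "matrix_inv D ** D = mat 1"
    using S(4) matrix_left_right_inverse by metis+
  have cancel: "D *v (matrix_inv D *v y) = y" "matrix_inv D *v (D *v y) = y" for y
    using inv by (simp_all add: matrix_vector_mul_assoc)
  have "Q = D + U + transpose U"
    using block_decomposition[of Q blk] assms by (simp add: pos_def_def)
  then have "Q_hat blk Q = D + U + transpose U + U ** matrix_inv D ** transpose U"
    by (simp add: Q_hat_def sgs_op_def D_def U_def)
  then show ?thesis
    by (simp add: matrix_eq matrix_vector_mul_assoc[symmetric] matrix_vector_mult_add_rdistrib
        vec.add cancel del: transpose_matrix_vector)
qed

section \<open>Bounding the contribution of the error vectors\<close>

lemma norm_le_spectral_norm: "norm (A *v x) \<le> spectral_norm A * norm x"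
  unfolding spectral_norm_def by (intro onorm) simp

lemma spectral_norm_nonneg: "0 \<le> spectral_norm A"
  unfolding spectral_norm_def by (intro onorm_pos_le) simp

lemma norm_eq_inner_symmetric_square:
  fixes S :: "real^'n^'n"
  assumes "transpose S = S"
  shows "(norm (S *v x))\<^sup>2 = x \<bullet> (S ** S *v x)"
  unfolding power2_norm_eq_inner matrix_vector_mul_assoc[symmetric]
  by (subst (2) inner_transpose_matrix_vector) (simp only: assms)

text \<open>The two summands of \<open>error_const\<close> come from the two parts of the error:
  \<delta> - \<delta>' has norm at most 2 \<epsilon> and passes through D^(-1/2), while \<delta>'
  passes through H^(-1/2).\<close>

lemma sgs_error_bound:
  assumes Q: "pos_def Q" and \<delta>: "norm \<delta>' \<le> \<epsilon>" "norm \<delta> \<le> \<epsilon>"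
  shows "norm (mat_inv_sqrt (Q_hat blk Q) *v sgs_error blk Q \<delta>' \<delta>) \<le> error_const blk Q * \<epsilon>"
proof -
  define D U H where "D = block_diag blk Q" and "U = block_upper blk Q" and "H = Q_hat blk Q"
  define S K where "S = mat_inv_sqrt D" and "K = mat_inv_sqrt H"
  define \<eta> where "\<eta> = \<delta> - \<delta>'"
  have D: "pos_def D" using Q by (simp add: D_def pos_def_block_diag)
  have H: "pos_def H" using Q by (simp add: H_def pos_def_Q_hat)
  note S = mat_inv_sqrt[OF D, folded S_def]
  note K = mat_inv_sqrt[OF H, folded K_def]
  define G where "G = (D + U) ** S"
  have DS: "D ** S ** S = mat 1"
    using mat_sqrt(2)[OF pos_def_imp_pos_semidef[OF D]] S(1)
    by (metis matrix_mul_assoc matrix_mul_rid)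
  have tG: "transpose G = S ** (D + transpose U)"
    using D by (simp add: G_def matrix_transpose_mul S(3) transpose_add pos_def_def)
  have HG: "H = G ** transpose G"
    unfolding tG using Q_hat_factorization[OF Q D_def U_def, folded H_def]
    by (simp add: G_def S(4)[symmetric] matrix_mul_assoc)
  \<comment> \<open>The D part of G S reproduces \<eta>, which together with \<delta>' restores the
    leading \<delta>.\<close>
  have \<Delta>: "sgs_error blk Q \<delta>' \<delta> = G *v (S *v \<eta>) + \<delta>'"
  proof -
    have "D *v (S *v (S *v \<eta>)) = \<eta>" using DS by (simp add: matrix_vector_mul_assoc matrix_mul_assoc)
    then show ?thesis
      by (simp add: sgs_error_def D_def[symmetric] U_def[symmetric] G_def S(4)[symmetric]
          matrix_vector_mul_assoc[symmetric] matrix_vector_mult_add_rdistrib \<eta>_def)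
  qed
  have KG: "norm (K *v (G *v \<zeta>)) \<le> norm \<zeta>" for \<zeta>
  proof -
    \<comment> \<open>Here z = H^(-1) G \<zeta>. Since H = G \<open>transpose G\<close>, the vector
      w = \<open>transpose G\<close> z has the same norm as K G \<zeta>, while the square of that
      norm equals the inner product of w and \<zeta>; Cauchy-Schwarz then gives the
      contraction.\<close>
    define z where "z = K *v (K *v (G *v \<zeta>))"
    define w where "w = transpose G *v z"
    have KHK: "K ** H ** K = mat 1"
      using mat_sqrt(2)[OF pos_def_imp_pos_semidef[OF H]] K(1,2)
      by (metis matrix_mul_assoc matrix_mul_lid)
    have "(norm w)\<^sup>2 = z \<bullet> (H *v z)"
      unfolding w_def HG matrix_vector_mul_assoc[symmetric]
      by (simp add: power2_norm_eq_inner inner_transpose_matrix_vector del: transpose_matrix_vector)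
    also have "\<dots> = (K *v (G *v \<zeta>)) \<bullet> ((K ** H ** K) *v (K *v (G *v \<zeta>)))"
      unfolding z_def matrix_vector_mul_assoc[symmetric]
      by (subst (2) inner_transpose_matrix_vector) (simp only: K(3))
    finally have w: "norm w = norm (K *v (G *v \<zeta>))"
      by (simp add: KHK power2_norm_eq_inner[symmetric])
    have "(norm (K *v (G *v \<zeta>)))\<^sup>2 = (G *v \<zeta>) \<bullet> z"
      by (simp add: norm_eq_inner_symmetric_square[OF K(3)] z_def matrix_vector_mul_assoc[symmetric])
    also have "\<dots> = w \<bullet> \<zeta>"
      unfolding w_def inner_transpose_matrix_vector[symmetric] by (rule inner_commute)
    also have "\<dots> \<le> norm (K *v (G *v \<zeta>)) * norm \<zeta>" using norm_cauchy_schwarz w by metis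
    finally show ?thesis by (cases "K *v (G *v \<zeta>) = 0") (auto simp: power2_eq_square)
  qed
  have "norm (K *v sgs_error blk Q \<delta>' \<delta>) \<le> norm (K *v (G *v (S *v \<eta>))) + norm (K *v \<delta>')"
    unfolding \<Delta> vec.add by (rule norm_triangle_ineq)
  also have "\<dots> \<le> norm (S *v \<eta>) + spectral_norm K * norm \<delta>'"
    by (intro add_mono KG norm_le_spectral_norm)
  also have "\<dots> \<le> spectral_norm S * norm \<eta> + spectral_norm K * norm \<delta>'"
    by (intro add_mono norm_le_spectral_norm order_refl)
  also have "\<dots> \<le> spectral_norm S * (2 * \<epsilon>) + spectral_norm K * \<epsilon>"
  proof (intro add_mono mult_left_mono spectral_norm_nonneg \<delta>)
    show "norm \<eta> \<le> 2 * \<epsilon>" using \<delta> norm_triangle_ineq4[of \<delta> \<delta>'] by (simp add: \<eta>_def)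
  qed
  finally show ?thesis
    by (simp add: error_const_def K_def S_def H_def D_def algebra_simps)
qed

section \<open>The iteration matrix and its spectral bounds\<close>

text \<open>Since K H K is the identity and H = Q + T, subtracting K Q K leaves K T K.\<close>

lemma iteration_matrix_eq:
  fixes Q :: "real^'n^'n"
  assumes "pos_def Q" and K_def: "K = mat_inv_sqrt (Q_hat blk Q)"
  shows "iteration_matrix blk Q = K ** sgs_op blk Q ** K"
proof -
  note H = pos_def_Q_hat[OF assms(1), of blk]
  note K = mat_inv_sqrt[OF H, folded K_def]
  have "K ** Q_hat blk Q ** K = mat 1"
    using mat_sqrt(2)[OF pos_def_imp_pos_semidef[OF H]] K(1,2)
    by (metis matrix_mul_assoc matrix_mul_lid)
  then have "K *v (Q_hat blk Q *v (K *v x)) = x" for x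
    by (simp add: matrix_vector_mul_assoc matrix_mul_assoc)
  then have "x = K *v (Q *v (K *v x)) + K *v (sgs_op blk Q *v (K *v x))" for x
    by (simp add: Q_hat_def matrix_vector_mult_add_rdistrib vec.add)
  then show ?thesis
    by (simp add: iteration_matrix_def K_def[symmetric] matrix_eq
        matrix_vector_mult_diff_rdistrib matrix_vector_mul_assoc[symmetric] diff_eq_eq add.commute)
qed

lemma inner_congruence_symmetric:
  fixes A K :: "real^'n^'n"
  assumes "transpose K = K"
  shows "x \<bullet> (K ** A ** K *v y) = (K *v x) \<bullet> (A *v (K *v y))"
  by (simp only: matrix_vector_mul_assoc[symmetric] inner_transpose_matrix_vector[of x K] assms)

text \<open>Each bound uses its own form of B: B = K T K inherits semidefiniteness from T, and I - B
  = K Q K inherits definiteness from Q because K is injective.\<close>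

lemma iteration_matrix_bounds:
  assumes "pos_def Q"
  shows "0 \<preceq>\<^sub>L iteration_matrix blk Q" "iteration_matrix blk Q \<prec>\<^sub>L mat 1"
proof -
  define K where "K = mat_inv_sqrt (Q_hat blk Q)"
  note K = mat_inv_sqrt[OF pos_def_Q_hat[OF assms, of blk], folded K_def]
  show "0 \<preceq>\<^sub>L iteration_matrix blk Q"
    using pos_semidef_sgs_op[OF assms, of blk]
    by (simp add: loewner_le_def iteration_matrix_eq[OF assms K_def] pos_semidef_def
        matrix_transpose_mul K(3) matrix_mul_assoc inner_congruence_symmetric)
  have "K *v x \<noteq> 0" if "x \<noteq> 0" for x
    using that K(1) by (metis matrix_vector_mul_assoc matrix_vector_mul_lid matrix_vector_mult_0_right)
  then show "iteration_matrix blk Q \<prec>\<^sub>L mat 1"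
    using assms
    by (simp add: loewner_less_def iteration_matrix_def K_def[symmetric] pos_def_def
        matrix_transpose_mul K(3) matrix_mul_assoc inner_congruence_symmetric)
qed

section \<open>Variational inequalities and the estimate for one iteration\<close>

text \<open>A single reference point with finite p bounds the minimum away from \<infinity>. The
  argument can then pass from extended to real arithmetic.\<close>

lemma composite_minimizer_finite:
  assumes "is_arg_min (\<lambda>z. p (F z) + ereal (\<phi> z)) (\<lambda>_. True) x"
    and "\<And>u. p u \<noteq> -\<infinity>" "p (F z) < \<infinity>"
  obtains r where "p (F x) = ereal r"
proof -
  have "\<not> p (F z) + ereal (\<phi> z) < p (F x) + ereal (\<phi> x)"
    using assms(1) by (auto simp: is_arg_min_def)
  with assms(3) have "p (F x) \<noteq> \<infinity>" by (cases "p (F z)") auto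
  with assms(2)[of "F x"] that show thesis by (cases "p (F x)") auto
qed

text \<open>Compare x with the points of the segment towards y: there p lies below its chord and
  \<phi> is an exact quadratic with slope g at x, so the first-order coefficient py - px + g cannot
  be negative.\<close>

lemma composite_minimizer_inequality:
  assumes "convex (epi p)" and F: "linear F"
    and quadr: "\<And>\<tau>. \<phi> (x + \<tau> *\<^sub>R (y - x)) = \<phi> x + \<tau> * g + \<tau>\<^sup>2 * c"
    and min: "is_arg_min (\<lambda>z. p (F z) + ereal (\<phi> z)) (\<lambda>_. True) x"
    and px: "p (F x) = ereal px" and py: "p (F y) = ereal py"
  shows "px \<le> py + g"
proof -
  have "0 \<le> \<tau> * (py - px + g) + \<tau>\<^sup>2 * c" if \<tau>: "0 < \<tau>" "\<tau> \<le> 1" for \<tau>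
  proof -
    let ?z = "x + \<tau> *\<^sub>R (y - x)"
    \<comment> \<open>Convexity of p is stated through its epigraph, so points are combined together
      with their values.\<close>
    have "(1 - \<tau>) *\<^sub>R (F x, px) + \<tau> *\<^sub>R (F y, py) \<in> epi p"
      using assms(1) \<tau> px py by (intro convexD) (auto simp: epi_def)
    moreover have "F ?z = (1 - \<tau>) *\<^sub>R F x + \<tau> *\<^sub>R F y"
      by (simp add: linear_add[OF F] linear_scale[OF F] linear_diff[OF F] algebra_simps)
    ultimately have pz: "p (F ?z) \<le> ereal ((1 - \<tau>) * px + \<tau> * py)" by (simp add: epi_def)
    have "ereal (px + \<phi> x) \<le> p (F ?z) + ereal (\<phi> ?z)"
      using min px by (auto simp: is_arg_min_def not_less)
    also have "\<dots> \<le> ereal ((1 - \<tau>) * px + \<tau> * py) + ereal (\<phi> ?z)"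
      by (intro add_mono pz order_refl)
    finally have "px + \<phi> x \<le> (1 - \<tau>) * px + \<tau> * py + \<phi> ?z" by simp
    then show ?thesis unfolding quadr by (simp add: algebra_simps)
  qed
  from linear_coeff_nonneg_of_quadratic_nonneg[OF this] show ?thesis by simp
qed

lemma quad_along_line:
  fixes Q :: "real^'n^'n"
  assumes "transpose Q = Q"
  shows "quad Q b (x + \<tau> *\<^sub>R h) =
    quad Q b x + \<tau> * ((Q *v x - b) \<bullet> h) + \<tau>\<^sup>2 * (1/2 * (h \<bullet> (Q *v h)))"
proof -
  have "x \<bullet> (Q *v h) = h \<bullet> (Q *v x)"
    using inner_transpose_matrix_vector[of x Q h] assms by (simp add: inner_commute)
  then show ?thesis
    by (simp add: quad_def vec.add matrix_vector_mult_scaleR inner_add inner_diff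
        power2_eq_square algebra_simps inner_commute[of "Q *v x"])
qed

text \<open>Lets \<open>quad_along_line\<close> expand the proximal term too.\<close>

lemma weighted_norm_sq_eq_quad: "1/2 * weighted_norm_sq T x = quad T 0 x"
  by (simp add: weighted_norm_sq_def quad_def)

lemma linear_first_block: "linear (first_block e)"
  by (intro linearI) (simp_all add: first_block_def vec_eq_iff)

lemma sgs_step_contraction:
  fixes Q :: "real^'n^'n" and p :: "real^'m \<Rightarrow> ereal"
  assumes Q: "pos_def Q" and p: "convex (epi p)"
    and min: "is_arg_min (step_objective blk e p Q b y \<delta>' \<delta>) (\<lambda>_. True) x"
    and opt: "is_arg_min (objective e p Q b) (\<lambda>_. True) x_opt"
    and fin: "p (first_block e x) = ereal px" "p (first_block e x_opt) = ereal po"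
    and R_def: "R = mat_sqrt (Q_hat blk Q)"
  shows "norm (R *v (x - x_opt)) \<le> spectral_norm (iteration_matrix blk Q) * norm (R *v (y - x_opt))
    + norm (mat_inv_sqrt (Q_hat blk Q) *v sgs_error blk Q \<delta>' \<delta>)"
proof -
  define T \<Delta> where "T = sgs_op blk Q" and "\<Delta> = sgs_error blk Q \<delta>' \<delta>"
  define w v where "w = x - x_opt" and "v = y - x_opt"
  define K where "K = mat_inv_sqrt (Q_hat blk Q)"
  note H = pos_def_Q_hat[OF Q, of blk]
  note R = mat_sqrt[OF pos_def_imp_pos_semidef[OF H], folded R_def]
  have tR: "transpose R = R" using R(1) by (simp add: pos_semidef_def)
  note K = mat_inv_sqrt[OF H, folded K_def R_def]
  have tQ: "transpose Q = Q" using Q by (simp add: pos_def_def)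
  have tT: "transpose T = T" using pos_semidef_sgs_op[OF Q, of blk] by (simp add: pos_semidef_def T_def)
  let ?\<phi> = "\<lambda>z. quad Q b z + 1/2 * weighted_norm_sq T (z - y) - z \<bullet> \<Delta>"
  \<comment> \<open>The linear coefficient pairs the gradient at x of the smooth part of the
    subproblem with the direction \<open>x_opt - x\<close>.\<close>
  have "?\<phi> (x + \<tau> *\<^sub>R (x_opt - x)) = ?\<phi> x
      + \<tau> * ((Q *v x - b + T *v (x - y) - \<Delta>) \<bullet> (x_opt - x))
      + \<tau>\<^sup>2 * (1/2 * ((x_opt - x) \<bullet> (Q *v (x_opt - x)))
        + 1/2 * ((x_opt - x) \<bullet> (T *v (x_opt - x))))" for \<tau>
  proof -
    have shift: "x + \<tau> *\<^sub>R (x_opt - x) - y = (x - y) + \<tau> *\<^sub>R (x_opt - x)" by simp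
    show ?thesis
      unfolding weighted_norm_sq_eq_quad shift quad_along_line[OF tQ] quad_along_line[OF tT]
      by (simp add: inner_add_left inner_diff_left[of _ _ "x_opt - x"] inner_commute[of \<Delta>]
          distrib_left right_diff_distrib)
  qed
  from composite_minimizer_inequality[OF p linear_first_block this _ fin] min
  have 1: "px \<le> po + (Q *v x - b + T *v (x - y) - \<Delta>) \<bullet> (x_opt - x)"
    by (simp add: step_objective_def[abs_def] T_def \<Delta>_def)
  from composite_minimizer_inequality[OF p linear_first_block quad_along_line[OF tQ] _ fin(2,1)] opt
  have 2: "po \<le> px + (Q *v x_opt - b) \<bullet> (x - x_opt)"
    by (simp add: objective_def[abs_def])
  \<comment> \<open>Adding \<open>1\<close> and \<open>2\<close> cancels px, po and b; the rest
    follows from x - y = w - v.\<close>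
  have "w \<bullet> (Q *v w) + w \<bullet> (T *v w) \<le> w \<bullet> (T *v v) + w \<bullet> \<Delta>"
    using 1 2 by (simp add: w_def v_def vec.diff inner_diff inner_add inner_commute algebra_simps)
  moreover have "w \<bullet> (Q *v w) + w \<bullet> (T *v w) = (norm (R *v w))\<^sup>2"
    by (simp add: norm_eq_inner_symmetric_square[OF tR] R(2) Q_hat_def T_def
        matrix_vector_mult_add_rdistrib inner_add_right)
  \<comment> \<open>K R is the identity, so inserting it on both sides of T produces B = K T
    K.\<close>
  moreover have "w \<bullet> (T *v v) = (R *v w) \<bullet> (iteration_matrix blk Q *v (R *v v))"
    unfolding iteration_matrix_eq[OF Q refl] inner_congruence_symmetric[OF K(3)[unfolded K_def]]
    by (simp add: matrix_vector_mul_assoc K(2)[unfolded K_def] T_def)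
  moreover have "w \<bullet> \<Delta> = (R *v w) \<bullet> (K *v \<Delta>)"
    using inner_transpose_matrix_vector[of w R "K *v \<Delta>"] tR K(1)
    by (simp add: matrix_vector_mul_assoc)
  ultimately have "(norm (R *v w))\<^sup>2 \<le> (R *v w) \<bullet> (iteration_matrix blk Q *v (R *v v) + K *v \<Delta>)"
    by (simp add: inner_add_right)
  also have "\<dots> \<le> norm (R *v w) * norm (iteration_matrix blk Q *v (R *v v) + K *v \<Delta>)"
    by (rule norm_cauchy_schwarz)
  finally have "norm (R *v w) \<le> norm (iteration_matrix blk Q *v (R *v v) + K *v \<Delta>)"
    by (cases "R *v w = 0") (auto simp: power2_eq_square)
  also have "\<dots> \<le> spectral_norm (iteration_matrix blk Q) * norm (R *v v) + norm (K *v \<Delta>)"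
    by (intro norm_triangle_le add_mono norm_le_spectral_norm order_refl)
  finally show ?thesis by (simp add: w_def v_def K_def \<Delta>_def)
qed

section \<open>Unrolling the one-step estimate along the whole run\<close>

lemma perturbed_linear_recurrence_bound:
  fixes a \<epsilon> :: "nat \<Rightarrow> real"
  assumes "0 \<le> r" and step: "\<And>k. a (Suc k) \<le> r * a k + M * \<epsilon> (Suc k)"
  shows "a k \<le> r ^ k * a 0 + M * (\<Sum>j=1..k. r ^ (k - j) * \<epsilon> j)"
proof (induction k)
  case 0
  then show ?case by simp
next
  case (Suc k)
  \<comment> \<open>The newest term carries \<open>r ^ 0\<close>, which is 1 even for r = 0, in
    agreement with the convention 0^0 = 1.\<close>
  have "(\<Sum>j=1..Suc k. r ^ (Suc k - j) * \<epsilon> j) = r * (\<Sum>j=1..k. r ^ (k - j) * \<epsilon> j) + \<epsilon> (Suc k)"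
    by (simp add: sum_distrib_left Suc_diff_le mult.assoc)
  moreover have "a (Suc k) \<le> r * (r ^ k * a 0 + M * (\<Sum>j=1..k. r ^ (k - j) * \<epsilon> j)) + M * \<epsilon> (Suc k)"
    using step[of k] mult_left_mono[OF Suc assms(1)] by linarith
  ultimately show ?case by (simp add: algebra_simps)
qed

theorem theorem3:
  fixes s :: nat
    and blk :: "'n::finite \<Rightarrow> nat" and e :: "'m::finite \<Rightarrow> 'n"
    and Q :: "real^'n^'n" and b :: "real^'n"
    and p :: "real^'m \<Rightarrow> ereal"
    and \<epsilon> t :: "nat \<Rightarrow> real"
    and \<delta>' \<delta> xt x :: "nat \<Rightarrow> real^'n"
    and x_opt :: "real^'n"
  assumes "2 \<le> s"
    and "block_structure s blk e"
    and "pos_semidef Q"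
    and "\<forall>i\<in>{1..s}. diag_block_pos_def blk Q i"
    and "proper_closed_convex p"
    and "rel_interior (eff_dom p) \<noteq> {}"
    and "pos_def Q"
    and "algorithm_run blk e p Q b \<epsilon> t \<delta>' \<delta> xt x"
    and "\<forall>k\<ge>1. t k = 1"
    and "is_arg_min (objective e p Q b) (\<lambda>_. True) x_opt"
  shows "(\<forall>k\<ge>1.
            norm (mat_sqrt (Q_hat blk Q) *v (x k - x_opt))
            \<le> spectral_norm (iteration_matrix blk Q) ^ k
                * norm (mat_sqrt (Q_hat blk Q) *v (x 0 - x_opt))
              + error_const blk Q
                * (\<Sum>j=1..k. spectral_norm (iteration_matrix blk Q) ^ (k - j) * \<epsilon> j))
         \<and> 0 \<preceq>\<^sub>L iteration_matrix blk Q
         \<and> iteration_matrix blk Q \<prec>\<^sub>L mat 1"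
proof -
  note Q = \<open>pos_def Q\<close> and opt = assms(10)
  have p: "convex (epi p)" "\<And>u. p u \<noteq> -\<infinity>"
    using assms(5) by (auto simp: proper_closed_convex_def)
  have x0: "xt 1 = x 0" "p (first_block e (x 0)) < \<infinity>"
    using assms(8) by (auto simp: algorithm_run_def eff_dom_def)
  \<comment> \<open>With \<open>t k = 1\<close> the tolerance is \<epsilon> k itself and the
    extrapolation coefficient vanishes.\<close>
  have run: "norm (\<delta>' k) \<le> \<epsilon> k" "norm (\<delta> k) \<le> \<epsilon> k"
      "is_arg_min (step_objective blk e p Q b (xt k) (\<delta>' k) (\<delta> k)) (\<lambda>_. True) (x k)"
      "xt (Suc k) = x k"
    if "1 \<le> k" for k
    using assms(8,9) that by (auto simp: algorithm_run_def)
  \<comment> \<open>Index 0 is covered by the initial condition \<open>xt 1 = x 0\<close>, all later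
    ones by the update rule.\<close>
  have xt: "xt (Suc k) = x k" for k
    using run(4)[of k] x0(1) by (cases k) auto
  \<comment> \<open>The starting point, whose first block lies in the domain of p, serves as the
    finite reference point here and for every subproblem.\<close>
  obtain po where po: "p (first_block e x_opt) = ereal po"
    using opt p(2) x0(2) unfolding objective_def[abs_def] by (rule composite_minimizer_finite)
  let ?a = "\<lambda>k. norm (mat_sqrt (Q_hat blk Q) *v (x k - x_opt))"
  have "?a (Suc k) \<le> spectral_norm (iteration_matrix blk Q) * ?a k
      + error_const blk Q * \<epsilon> (Suc k)" for k
  proof -
    have min: "is_arg_min (step_objective blk e p Q b (x k) (\<delta>' (Suc k)) (\<delta> (Suc k)))
        (\<lambda>_. True) (x (Suc k))"
      using run(3)[of "Suc k"] by (simp add: xt)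
    obtain px where px: "p (first_block e (x (Suc k))) = ereal px"
      using min p(2) x0(2) unfolding step_objective_def[abs_def]
      by (rule composite_minimizer_finite)
    from sgs_step_contraction[OF Q p(1) min opt px po refl]
      sgs_error_bound[OF Q run(1,2)[of "Suc k"], of blk]
    show ?thesis by simp
  qed
  from perturbed_linear_recurrence_bound[of _ ?a, OF spectral_norm_nonneg this]
  show ?thesis using iteration_matrix_bounds[OF Q] by blast
qed

end
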